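(* Let $T=(T^-,\mathcal{G})$ be a \emph{nonempty} causal multiteam of signature $\sigma$ and $\mathcal F$ a function component of signature $\sigma$. Then $T\models \Phi^\mathcal{F} \iff \mathcal{G}=\mathcal{F}$.
   Context: A causal multiteam $T=(T^-,\mathcal G)$ of signature $\sigma=(\mathrm{Dom},\mathrm{Ran})$ consists of a finite multiset $T^-$ of assignments on $\mathrm{Dom}$ and a (recursive) function component $\mathcal G$ assigning to each endogenous variable $V$ a non-constant function $\mathcal G_V$ of all the other variables $\mathbf W_V$ (listed in a fixed order), compatible with $T^-$. For a function component $\mathcal F$ with endogenous variables $End(\mathcal F)$, define the $\mathcal{CO}$ formula $\Phi^\mathcal{F}=\bigwedge_{V\in End(\mathcal{F})}\eta_\sigma(V)\land\bigwedge_{V\notin End(\mathcal F)}\xi_\sigma(V)$, where $\eta_\sigma(V)=\bigwedge_{\mathbf w\in\mathrm{Ran}(\mathbf W_V)}(\mathbf W_V=\mathbf w\,\Box\!\!\rightarrow V=\mathcal F_V(\mathbf w))$ and $\xi_\sigma(V)=\bigwedge_{\mathbf w\in\mathrm{Ran}(\mathbf W_V),\,v\in\mathrm{Ran}(V)}V=v\supset(\mathbf W_V=\mathbf w\,\Box\!\!\rightarrow V=v)$. Here $\Box\!\!\rightarrow$ is the interventionist counterfactual (true iff the consequent holds after intervening to set the antecedent variables) and $\supset$ is selective implication (true iff the consequent holds in the sub-multiteam of assignments satisfying the antecedent). *)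

theory Defs
  imports "HOL-Library.Multiset" "HOL-Library.FuncSet"
begin

section \<open>Signatures and assignments\<close>

text \<open>The list \<open>Dom\<close> fixes both the set of variables and the order in which tuples of
  variables are read. Tuples of variables and of values are lists.\<close>

record ('v, 'a) sig =
  Dom :: "'v list"
  Ran :: "'v \<Rightarrow> 'a set"

definition signature :: "('v, 'a) sig \<Rightarrow> bool" where
  "signature \<sigma> \<longleftrightarrow> Dom \<sigma> \<noteq> [] \<and> distinct (Dom \<sigma>) \<and>
     (\<forall>V\<in>set (Dom \<sigma>). finite (Ran \<sigma> V) \<and> Ran \<sigma> V \<noteq> {})"

definition assignments :: "('v, 'a) sig \<Rightarrow> ('v \<Rightarrow> 'a) set" where
  "assignments \<sigma> = (\<Pi>\<^sub>E V\<in>set (Dom \<sigma>). Ran \<sigma> V)"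

definition others :: "('v, 'a) sig \<Rightarrow> 'v \<Rightarrow> 'v list" where
  "others \<sigma> V = filter (\<lambda>X. X \<noteq> V) (Dom \<sigma>)"

definition Ran_tuple :: "('v, 'a) sig \<Rightarrow> 'v list \<Rightarrow> 'a list set" where
  "Ran_tuple \<sigma> Xs = listset (map (Ran \<sigma>) Xs)"

section \<open>Function components and causal multiteams\<close>

text \<open>A function component is a partial map whose domain is the set of endogenous variables.
  The functions are extensional, so that HOL equality of function components is equality of the
  sets of endogenous variables and of the functions on \<open>Ran(W\<^sub>V)\<close>.\<close>

type_synonym ('v, 'a) fcomp = "'v \<rightharpoonup> ('a list \<Rightarrow> 'a)"

definition function_component :: "('v, 'a) sig \<Rightarrow> ('v, 'a) fcomp \<Rightarrow> bool" where
  "function_component \<sigma> F \<longleftrightarrow> dom F \<subseteq> set (Dom \<sigma>) \<and>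
     (\<forall>V f. F V = Some f \<longrightarrow>
        f \<in> Ran_tuple \<sigma> (others \<sigma> V) \<rightarrow>\<^sub>E Ran \<sigma> V \<and>
        (\<exists>w\<in>Ran_tuple \<sigma> (others \<sigma> V). \<exists>w'\<in>Ran_tuple \<sigma> (others \<sigma> V). f w \<noteq> f w'))"

text \<open>There is an edge from \<open>X\<close> to \<open>V\<close> iff changing the value of \<open>X\<close> alone can change the
  value of the function for \<open>V\<close>.\<close>

definition causal_graph :: "('v, 'a) sig \<Rightarrow> ('v, 'a) fcomp \<Rightarrow> ('v \<times> 'v) set" where
  "causal_graph \<sigma> F = {(X, V). X \<in> set (others \<sigma> V) \<and>
     (\<exists>f. F V = Some f \<and>
        (\<exists>s\<in>assignments \<sigma>. \<exists>x\<in>Ran \<sigma> X.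
           f (map (s(X := x)) (others \<sigma> V)) \<noteq> f (map s (others \<sigma> V))))}"

definition recursive :: "('v, 'a) sig \<Rightarrow> ('v, 'a) fcomp \<Rightarrow> bool" where
  "recursive \<sigma> F \<longleftrightarrow> acyclic (causal_graph \<sigma> F)"

type_synonym ('v, 'a) multiteam = "('v \<Rightarrow> 'a) multiset"

type_synonym ('v, 'a) causal_mt = "('v, 'a) multiteam \<times> ('v, 'a) fcomp"

definition compatible :: "('v, 'a) sig \<Rightarrow> ('v, 'a) fcomp \<Rightarrow> ('v \<Rightarrow> 'a) \<Rightarrow> bool" where
  "compatible \<sigma> F s \<longleftrightarrow> (\<forall>V f. F V = Some f \<longrightarrow> s V = f (map s (others \<sigma> V)))"

definition causal_multiteam :: "('v, 'a) sig \<Rightarrow> ('v, 'a) causal_mt \<Rightarrow> bool" where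
  "causal_multiteam \<sigma> T \<longleftrightarrow>
     set_mset (fst T) \<subseteq> assignments \<sigma> \<and>
     function_component \<sigma> (snd T) \<and> recursive \<sigma> (snd T) \<and>
     (\<forall>s\<in>#fst T. compatible \<sigma> (snd T) s)"

section \<open>Interventions\<close>

text \<open>An intervention \<open>\<^bold>X = \<^bold>x\<close> is given as the list of its equalities \<open>X = x\<close>.
  The intervened assignment is well defined for recursive function components
  (lemma \<open>intervened_ex1\<close>).\<close>

definition intervened ::
    "('v, 'a) sig \<Rightarrow> ('v, 'a) fcomp \<Rightarrow> ('v \<times> 'a) list \<Rightarrow> ('v \<Rightarrow> 'a) \<Rightarrow> ('v \<Rightarrow> 'a) \<Rightarrow> bool" where
  "intervened \<sigma> F Xx s s' \<longleftrightarrow> s' \<in> assignments \<sigma> \<and>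
     (\<forall>V\<in>set (Dom \<sigma>). s' V =
        (case map_of Xx V of
           Some x \<Rightarrow> x
         | None \<Rightarrow> (case F V of None \<Rightarrow> s V | Some f \<Rightarrow> f (map s' (others \<sigma> V)))))"

definition do_assignment ::
    "('v, 'a) sig \<Rightarrow> ('v, 'a) fcomp \<Rightarrow> ('v \<times> 'a) list \<Rightarrow> ('v \<Rightarrow> 'a) \<Rightarrow> ('v \<Rightarrow> 'a)" where
  "do_assignment \<sigma> F Xx s = (THE s'. intervened \<sigma> F Xx s s')"

definition do_intervention ::
    "('v, 'a) sig \<Rightarrow> ('v \<times> 'a) list \<Rightarrow> ('v, 'a) causal_mt \<Rightarrow> ('v, 'a) causal_mt" where
  "do_intervention \<sigma> Xx T =
     (image_mset (do_assignment \<sigma> (snd T) Xx) (fst T), snd T |` (- fst ` set Xx))"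

definition consistent :: "('v \<times> 'a) list \<Rightarrow> bool" where
  "consistent Xx \<longleftrightarrow> (\<forall>X x x'. (X, x) \<in> set Xx \<longrightarrow> (X, x') \<in> set Xx \<longrightarrow> x = x')"

lemma Ran_tuple_map:
  assumes "s \<in> assignments \<sigma>" "set Xs \<subseteq> set (Dom \<sigma>)"
  shows "map s Xs \<in> Ran_tuple \<sigma> Xs"
  using assms by (induction Xs) (auto simp: Ran_tuple_def assignments_def set_Cons_def)

lemma others_subset: "set (others \<sigma> V) \<subseteq> set (Dom \<sigma>) - {V}"
  by (auto simp: others_def)

lemma depends_on_parents:
  assumes "F V = Some f" and s: "s \<in> assignments \<sigma>" and t: "t \<in> assignments \<sigma>"
    and eq: "\<And>U. (U, V) \<in> causal_graph \<sigma> F \<Longrightarrow> s U = t U"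
  shows "f (map s (others \<sigma> V)) = f (map t (others \<sigma> V))"
proof -
  let ?W = "others \<sigma> V"
  have "f (map (override_on s t A) ?W) = f (map s ?W)" if "finite A" "A \<subseteq> set ?W" for A
    using that
  proof (induction A rule: finite_induct)
    case empty
    then show ?case by simp
  next
    case (insert X A)
    let ?r = "override_on s t A"
    have r: "?r \<in> assignments \<sigma>"
      using s t by (auto simp: assignments_def override_on_def PiE_iff extensional_def)
    have X: "X \<in> set ?W" "t X \<in> Ran \<sigma> X"
      using insert.prems t others_subset[of \<sigma> V] by (auto simp: assignments_def)
    have upd: "override_on s t (insert X A) = ?r(X := t X)"
      by (auto simp: override_on_def)
    have "f (map (?r(X := t X)) ?W) = f (map ?r ?W)"
    proof (cases "(X, V) \<in> causal_graph \<sigma> F")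
      case True
      then have "?r(X := t X) = ?r" using eq by (auto simp: override_on_def)
      then show ?thesis by simp
    next
      case False
      then show ?thesis using r X assms(1) unfolding causal_graph_def by blast
    qed
    also have "\<dots> = f (map s ?W)" using insert by simp
    finally show ?case by (simp only: upd)
  qed
  from this[of "set ?W"] show ?thesis by (simp cong: map_cong)
qed

lemma wf_causal_graph:
  assumes "recursive \<sigma> F" "function_component \<sigma> F"
  shows "wf (causal_graph \<sigma> F)"
proof (rule finite_acyclic_wf)
  have "causal_graph \<sigma> F \<subseteq> set (Dom \<sigma>) \<times> set (Dom \<sigma>)"
    using assms(2) others_subset by (fastforce simp: causal_graph_def function_component_def)
  then show "finite (causal_graph \<sigma> F)" by (rule finite_subset) simp
qed (use assms(1) in \<open>simp add: recursive_def\<close>)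

lemma intervened_ex1:
  assumes F: "function_component \<sigma> F" "recursive \<sigma> F"
    and s: "s \<in> assignments \<sigma>"
    and Xx: "\<And>X x. (X, x) \<in> set Xx \<Longrightarrow> x \<in> Ran \<sigma> X"
  shows "\<exists>!s'. intervened \<sigma> F Xx s s'"
proof (rule ex_ex1I)
  let ?R = "causal_graph \<sigma> F"
  note wf = wf_causal_graph[OF F(2,1)]
  let ?mix = "\<lambda>h V U. if (U, V) \<in> ?R then h U else s U"
  define H where "H = (\<lambda>h V. if V \<notin> set (Dom \<sigma>) then undefined else
        (case map_of Xx V of
           Some x \<Rightarrow> x
         | None \<Rightarrow> (case F V of None \<Rightarrow> s V | Some f \<Rightarrow> f (map (?mix h V) (others \<sigma> V)))))"
  define h where "h = wfrec ?R H"
  have h: "h V = H h V" for V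
  proof -
    have "?mix (cut h ?R V) V = ?mix h V" by (auto simp: cut_def)
    then have "H (cut h ?R V) V = H h V" unfolding H_def by (simp only:)
    then show ?thesis using wfrec[OF wf, of H V] by (simp add: h_def)
  qed
  have dom: "(U, V) \<in> ?R \<Longrightarrow> U \<in> set (Dom \<sigma>)" for U V
    using others_subset by (fastforce simp: causal_graph_def)
  have mix: "?mix h V \<in> assignments \<sigma>"
    if "\<And>U. (U, V) \<in> ?R \<Longrightarrow> h U \<in> Ran \<sigma> U" for V
    using that s dom by (auto simp: assignments_def PiE_iff extensional_def)
  have ran: "V \<in> set (Dom \<sigma>) \<longrightarrow> h V \<in> Ran \<sigma> V" for V
    using wf
  proof (induction V rule: wf_induct_rule)
    case (less V)
    have "?mix h V \<in> assignments \<sigma>" using less dom by (intro mix) blast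
    then have "map (?mix h V) (others \<sigma> V) \<in> Ran_tuple \<sigma> (others \<sigma> V)"
      using others_subset by (fast intro: Ran_tuple_map)
    then have "f (map (?mix h V) (others \<sigma> V)) \<in> Ran \<sigma> V" if "F V = Some f" for f
      using that F(1) unfolding function_component_def by blast
    then show ?case
      unfolding h[of V] using s Xx
      by (auto simp: H_def assignments_def dest: map_of_SomeD split: option.splits)
  qed
  have hA: "h \<in> assignments \<sigma>"
    using ran by (auto simp: assignments_def PiE_iff extensional_def h H_def)
  have "f (map (?mix h V) (others \<sigma> V)) = f (map h (others \<sigma> V))" if "F V = Some f" for V f
    by (rule depends_on_parents[where F = F, OF that mix[of V] hA]) (use ran dom in auto)
  then have "intervened \<sigma> F Xx s h"
    unfolding intervened_def using hA
    by (subst h) (auto simp: H_def split: option.splits)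
  then show "\<exists>s'. intervened \<sigma> F Xx s s'" by blast
next
  fix p q assume p: "intervened \<sigma> F Xx s p" and q: "intervened \<sigma> F Xx s q"
  have A: "p \<in> assignments \<sigma>" "q \<in> assignments \<sigma>" using p q by (auto simp: intervened_def)
  have "p V = q V" for V
    using wf_causal_graph[OF F(2,1)]
  proof (induction V rule: wf_induct_rule)
    case (less V)
    show ?case
    proof (cases "V \<in> set (Dom \<sigma>)")
      case True
      have "f (map p (others \<sigma> V)) = f (map q (others \<sigma> V))" if "F V = Some f" for f
        using depends_on_parents[of F V f p \<sigma> q, OF that A] less.IH by blast
      then show ?thesis using p q True
        by (auto simp: intervened_def split: option.splits)
    next
      case False
      then show ?thesis using A by (auto simp: assignments_def PiE_iff extensional_def)
    qed
  qed
  then show "p = q" by (rule ext)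
qed

section \<open>The language CO\<close>

datatype ('v, 'a) co =
    Eq 'v 'a
  | Neq 'v 'a
  | And "('v, 'a) co" "('v, 'a) co"
  | Or "('v, 'a) co" "('v, 'a) co"
  | SelImp "('v, 'a) co" "('v, 'a) co"
  | Cf "('v \<times> 'a) list" "('v, 'a) co"

text \<open>\<open>Or\<close> is the tensor disjunction, \<open>SelImp \<alpha> \<psi>\<close> is \<open>\<alpha> \<supset> \<psi>\<close>, and \<open>Cf [(X\<^sub>1, x\<^sub>1), \<dots>] \<psi>\<close> is the
  counterfactual whose antecedent is the conjunction of the equalities \<open>X\<^sub>i = x\<^sub>i\<close>.\<close>

primrec sat :: "('v, 'a) sig \<Rightarrow> ('v, 'a) co \<Rightarrow> ('v, 'a) causal_mt \<Rightarrow> bool" where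
  "sat \<sigma> (Eq X x) T \<longleftrightarrow> (\<forall>s\<in>#fst T. s X = x)"
| "sat \<sigma> (Neq X x) T \<longleftrightarrow> (\<forall>s\<in>#fst T. s X \<noteq> x)"
| "sat \<sigma> (And \<phi> \<psi>) T \<longleftrightarrow> sat \<sigma> \<phi> T \<and> sat \<sigma> \<psi> T"
| "sat \<sigma> (Or \<phi> \<psi>) T \<longleftrightarrow>
     (\<exists>T1 T2. fst T = T1 + T2 \<and> sat \<sigma> \<phi> (T1, snd T) \<and> sat \<sigma> \<psi> (T2, snd T))"
| "sat \<sigma> (SelImp \<phi> \<psi>) T \<longleftrightarrow>
     sat \<sigma> \<psi> (filter_mset (\<lambda>s. sat \<sigma> \<phi> ({#s#}, snd T)) (fst T), snd T)"
| "sat \<sigma> (Cf Xx \<psi>) T \<longleftrightarrow> (consistent Xx \<longrightarrow> sat \<sigma> \<psi> (do_intervention \<sigma> Xx T))"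

text \<open>The empty conjunction (which arises when no variable, or every variable, is endogenous)
  is the tautology \<open>X = x \<supset> X = x\<close>.\<close>

definition Verum :: "('v, 'a) sig \<Rightarrow> ('v, 'a) co" where
  "Verum \<sigma> = (let X = hd (Dom \<sigma>); x = (SOME x. x \<in> Ran \<sigma> X) in SelImp (Eq X x) (Eq X x))"

text \<open>The conjunction of a finite set of formulas, taken in some order; the order is irrelevant
  to satisfaction (lemma \<open>sat_Conj\<close>).\<close>

definition Conj :: "('v, 'a) sig \<Rightarrow> ('v, 'a) co set \<Rightarrow> ('v, 'a) co" where
  "Conj \<sigma> A = foldr And (SOME \<phi>s. set \<phi>s = A \<and> distinct \<phi>s) (Verum \<sigma>)"

lemma sat_Conj:
  assumes "finite A"
  shows "sat \<sigma> (Conj \<sigma> A) T \<longleftrightarrow> (\<forall>\<phi>\<in>A. sat \<sigma> \<phi> T)"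
proof -
  define l where "l = (SOME \<phi>s. set \<phi>s = A \<and> distinct \<phi>s)"
  have "set l = A \<and> distinct l"
    unfolding l_def by (rule someI_ex) (rule finite_distinct_list[OF assms])
  moreover have "sat \<sigma> (foldr And \<phi>s (Verum \<sigma>)) T \<longleftrightarrow> (\<forall>\<phi>\<in>set \<phi>s. sat \<sigma> \<phi> T)" for \<phi>s
    by (induction \<phi>s) (auto simp: Verum_def Let_def)
  ultimately show ?thesis by (simp add: Conj_def l_def)
qed

section \<open>The formula characterizing a function component\<close>

definition eta :: "('v, 'a) sig \<Rightarrow> ('v, 'a) fcomp \<Rightarrow> 'v \<Rightarrow> ('v, 'a) co" where
  "eta \<sigma> F V = Conj \<sigma>
     {Cf (zip (others \<sigma> V) w) (Eq V (the (F V) w)) | w. w \<in> Ran_tuple \<sigma> (others \<sigma> V)}"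

definition xi :: "('v, 'a) sig \<Rightarrow> 'v \<Rightarrow> ('v, 'a) co" where
  "xi \<sigma> V = Conj \<sigma>
     {SelImp (Eq V v) (Cf (zip (others \<sigma> V) w) (Eq V v)) | w v.
        w \<in> Ran_tuple \<sigma> (others \<sigma> V) \<and> v \<in> Ran \<sigma> V}"

definition Phi :: "('v, 'a) sig \<Rightarrow> ('v, 'a) fcomp \<Rightarrow> ('v, 'a) co" where
  "Phi \<sigma> F = And (Conj \<sigma> (eta \<sigma> F ` dom F)) (Conj \<sigma> (xi \<sigma> ` (set (Dom \<sigma>) - dom F)))"

end

theory Submission
  imports Defs
begin

text \<open>Intervening on all variables other than \<open>V\<close> with \<open>w\<close> leaves \<open>V\<close> with the value
  \<open>\<G>\<^sub>V(w)\<close> if \<open>V\<close> is endogenous in \<open>\<G>\<close>, and with its old value otherwise. So the conjuncts of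
  \<open>\<Phi>\<close> say that these response functions agree with those of \<open>\<F>\<close>. A nonempty multiteam
  distinguishes the two cases, because the functions of a function component are not constant.\<close>

lemma Ran_tuple_iff: "w \<in> Ran_tuple \<sigma> Xs \<longleftrightarrow> list_all2 (\<lambda>X x. x \<in> Ran \<sigma> X) Xs w"
  by (induction Xs arbitrary: w) (auto simp: Ran_tuple_def set_Cons_def list_all2_Cons1)

lemma finite_Ran_tuple:
  assumes "signature \<sigma>" "set Xs \<subseteq> set (Dom \<sigma>)"
  shows "finite (Ran_tuple \<sigma> Xs)"
  using assms(2)
proof (induction Xs)
  case (Cons X Xs)
  have "Ran_tuple \<sigma> (X # Xs) = (\<lambda>(x, xs). x # xs) ` (Ran \<sigma> X \<times> Ran_tuple \<sigma> Xs)"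
    by (auto simp: Ran_tuple_def set_Cons_def)
  then show ?case using Cons assms(1) by (simp add: signature_def)
qed (simp add: Ran_tuple_def)

lemma consistent_zip: "distinct Xs \<Longrightarrow> consistent (zip Xs w)"
  by (auto simp: consistent_def in_set_zip distinct_conv_nth)

lemma distinct_others: "signature \<sigma> \<Longrightarrow> distinct (others \<sigma> V)"
  by (simp add: signature_def others_def)

text \<open>The antecedent fixes every variable except \<open>V\<close>, so the argument tuple in
  the equation for \<open>V\<close> is \<open>w\<close> itself, and no other structural equation
  affects the outcome.\<close>

lemma do_assignment_others:
  assumes \<sigma>: "signature \<sigma>" and F: "function_component \<sigma> F" "recursive \<sigma> F"
    and s: "s \<in> assignments \<sigma>" and V: "V \<in> set (Dom \<sigma>)"
    and w: "w \<in> Ran_tuple \<sigma> (others \<sigma> V)"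
  shows "do_assignment \<sigma> F (zip (others \<sigma> V) w) s V = (case F V of None \<Rightarrow> s V | Some f \<Rightarrow> f w)"
proof -
  let ?W = "others \<sigma> V"
  let ?Xx = "zip ?W w"
  define s' where "s' = do_assignment \<sigma> F ?Xx s"
  have len: "length w = length ?W"
    using w by (simp add: Ran_tuple_iff list_all2_lengthD)
  \<comment> \<open>Unique existence lets the \<open>THE\<close> in \<open>do_assignment\<close> be
    replaced by the equations of \<open>intervened\<close>; it requires the antecedent values to lie
    in their ranges.\<close>
  have "\<exists>!s'. intervened \<sigma> F ?Xx s s'"
    using F s by (rule intervened_ex1) (use w in \<open>auto simp: Ran_tuple_iff list_all2_iff\<close>)
  then have s': "intervened \<sigma> F ?Xx s s'"
    unfolding s'_def do_assignment_def by (rule theI')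
  have "map s' ?W = w"
  proof (rule nth_equalityI)
    fix i assume "i < length (map s' ?W)"
    then have i: "i < length ?W" by simp
    then have "?W ! i \<in> set (Dom \<sigma>)" using others_subset[of \<sigma> V] nth_mem by blast
    moreover have "map_of ?Xx (?W ! i) = Some (w ! i)"
      using i len distinct_others[OF \<sigma>] by (simp add: map_of_zip_nth)
    ultimately show "map s' ?W ! i = w ! i"
      using s' i by (simp add: intervened_def)
  qed (simp add: len)
  moreover have "map_of ?Xx V = None"
    using len by (simp add: map_of_zip_is_None others_def)
  ultimately show ?thesis
    using s' V by (simp add: intervened_def flip: s'_def split: option.splits)
qed

text \<open>Since \<open>others \<sigma> V\<close> has no repetitions, the antecedent is consistent
  and the counterfactual is not vacuous. \<open>T\<close> is only required to consist of
  assignments, so the result applies directly to the submultiteams selected in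
  \<open>sat_xi\<close>.\<close>

lemma sat_Cf_others:
  assumes "signature \<sigma>" "function_component \<sigma> G" "recursive \<sigma> G"
    and "set_mset T \<subseteq> assignments \<sigma>" "V \<in> set (Dom \<sigma>)" "w \<in> Ran_tuple \<sigma> (others \<sigma> V)"
  shows "sat \<sigma> (Cf (zip (others \<sigma> V) w) (Eq V v)) (T, G) \<longleftrightarrow>
    (\<forall>s\<in>#T. (case G V of None \<Rightarrow> s V | Some g \<Rightarrow> g w) = v)"
proof -
  have "do_assignment \<sigma> G (zip (others \<sigma> V) w) s V = (case G V of None \<Rightarrow> s V | Some g \<Rightarrow> g w)"
    if "s \<in># T" for s
    using assms that by (intro do_assignment_others) auto
  then show ?thesis
    by (simp add: do_intervention_def consistent_zip distinct_others[OF assms(1)])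
qed

lemma sat_eta:
  assumes "signature \<sigma>" "function_component \<sigma> G" "recursive \<sigma> G"
    and "set_mset T \<subseteq> assignments \<sigma>" "V \<in> set (Dom \<sigma>)"
  shows "sat \<sigma> (eta \<sigma> F V) (T, G) \<longleftrightarrow>
    (\<forall>w\<in>Ran_tuple \<sigma> (others \<sigma> V). \<forall>s\<in>#T.
      (case G V of None \<Rightarrow> s V | Some g \<Rightarrow> g w) = the (F V) w)"
proof -
  \<comment> \<open>Finiteness of the set of conjuncts is what \<open>sat_Conj\<close> asks
    for.\<close>
  have "finite (Ran_tuple \<sigma> (others \<sigma> V))"
    using assms(1) others_subset by (fast intro: finite_Ran_tuple)
  then have "sat \<sigma> (eta \<sigma> F V) (T, G) \<longleftrightarrow>
    (\<forall>w\<in>Ran_tuple \<sigma> (others \<sigma> V). sat \<sigma> (Cf (zip (others \<sigma> V) w) (Eq V (the (F V) w))) (T, G))"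
    unfolding eta_def by (subst sat_Conj) (auto simp del: sat.simps)
  then show ?thesis by (simp add: sat_Cf_others[OF assms] del: sat.simps)
qed

text \<open>The selective implications split \<open>T\<close> according to the value of
  \<open>V\<close>; on the part with value \<open>v\<close>, the counterfactual says that
  \<open>V\<close> keeps this value.\<close>

lemma sat_xi:
  assumes "signature \<sigma>" "function_component \<sigma> G" "recursive \<sigma> G"
    and T: "set_mset T \<subseteq> assignments \<sigma>" and V: "V \<in> set (Dom \<sigma>)"
  shows "sat \<sigma> (xi \<sigma> V) (T, G) \<longleftrightarrow>
    (\<forall>w\<in>Ran_tuple \<sigma> (others \<sigma> V). \<forall>s\<in>#T.
      (case G V of None \<Rightarrow> s V | Some g \<Rightarrow> g w) = s V)"
proof -
  let ?W = "others \<sigma> V"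
  have fin: "finite (Ran_tuple \<sigma> ?W)"
    using assms(1) others_subset by (fast intro: finite_Ran_tuple)
  have sel: "sat \<sigma> (SelImp (Eq V v) \<phi>) (T, G) \<longleftrightarrow> sat \<sigma> \<phi> (filter_mset (\<lambda>s. s V = v) T, G)" for v \<phi>
    by simp
  have "finite (Ran \<sigma> V)"
    using assms(1) V by (simp add: signature_def)
  with fin have "finite {SelImp (Eq V v) (Cf (zip ?W w) (Eq V v)) | w v.
      w \<in> Ran_tuple \<sigma> ?W \<and> v \<in> Ran \<sigma> V}"
    by (rule finite_image_set2[of "\<lambda>w. w \<in> Ran_tuple \<sigma> ?W" "\<lambda>v. v \<in> Ran \<sigma> V", simplified])
  then have "sat \<sigma> (xi \<sigma> V) (T, G) \<longleftrightarrow>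
    (\<forall>w\<in>Ran_tuple \<sigma> ?W. \<forall>v\<in>Ran \<sigma> V.
      sat \<sigma> (Cf (zip ?W w) (Eq V v)) (filter_mset (\<lambda>s. s V = v) T, G))"
    unfolding xi_def sel[symmetric] by (subst sat_Conj) blast+
  also have "\<dots> \<longleftrightarrow> (\<forall>w\<in>Ran_tuple \<sigma> ?W. \<forall>v\<in>Ran \<sigma> V. \<forall>s\<in>#filter_mset (\<lambda>s. s V = v) T.
      (case G V of None \<Rightarrow> s V | Some g \<Rightarrow> g w) = v)"
  proof -
    have "set_mset (filter_mset (\<lambda>s. s V = v) T) \<subseteq> assignments \<sigma>" for v
      using T by auto
    then show ?thesis
      by (simp add: sat_Cf_others[OF assms(1-3) _ V] del: sat.simps set_mset_filter)
  qed
  also have "\<dots> \<longleftrightarrow> (\<forall>w\<in>Ran_tuple \<sigma> ?W. \<forall>s\<in>#T.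
      (case G V of None \<Rightarrow> s V | Some g \<Rightarrow> g w) = s V)"
  proof -
    \<comment> \<open>Each \<open>s\<close> thus lies in a part that is tested, the one for
      \<open>v = s V\<close>, so the quantifier over \<open>v\<close> can be absorbed.\<close>
    have "s V \<in> Ran \<sigma> V" if "s \<in># T" for s
      using that T V by (auto simp: assignments_def)
    then show ?thesis by auto
  qed
  finally show ?thesis .
qed

text \<open>Used with \<open>c = s V\<close>, the constant response of an exogenous
  \<open>V\<close>: no endogenous variable can respond in this way.\<close>

lemma function_component_nonconstant:
  assumes "function_component \<sigma> F" "F V = Some f"
  shows "\<not> (\<forall>w\<in>Ran_tuple \<sigma> (others \<sigma> V). f w = c)"
  using assms unfolding function_component_def by metis

text \<open>The formula constrains functions only on admissible tuples; extensionality turns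
  agreement there into equality.\<close>

lemma function_component_extensional:
  assumes "function_component \<sigma> F" "F V = Some f"
  shows "f \<in> extensional (Ran_tuple \<sigma> (others \<sigma> V))"
  using assms unfolding function_component_def by (auto simp: PiE_iff)

theorem theorem9:
  fixes \<sigma> :: "('v, 'a) sig"
    and T :: "('v, 'a) multiteam"
    and G F :: "('v, 'a) fcomp"
  assumes "signature \<sigma>"
    and "causal_multiteam \<sigma> (T, G)"
    and "T \<noteq> {#}"
    and "function_component \<sigma> F"
  shows "sat \<sigma> (Phi \<sigma> F) (T, G) \<longleftrightarrow> G = F"
proof -
  have G: "function_component \<sigma> G" "recursive \<sigma> G" and T: "set_mset T \<subseteq> assignments \<sigma>"
    using assms(2) by (auto simp: causal_multiteam_def)
  have domF: "dom F \<subseteq> set (Dom \<sigma>)" and domG: "dom G \<subseteq> set (Dom \<sigma>)"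
    using assms(4) G by (auto simp: function_component_def)
  note eta = sat_eta[OF assms(1) G T]
  note xi = sat_xi[OF assms(1) G T]
  have "finite (dom F)" using domF by (rule finite_subset) simp
  then have Phi: "sat \<sigma> (Phi \<sigma> F) (T, G) \<longleftrightarrow>
      (\<forall>V\<in>dom F. sat \<sigma> (eta \<sigma> F V) (T, G)) \<and>
      (\<forall>V\<in>set (Dom \<sigma>) - dom F. sat \<sigma> (xi \<sigma> V) (T, G))"
    by (simp add: Phi_def sat_Conj)
  \<comment> \<open>This witness keeps the quantifiers over \<open>T\<close> from being
    vacuous.\<close>
  obtain s where s: "s \<in># T" using assms(3) by blast
  show ?thesis
  proof
    assume "sat \<sigma> (Phi \<sigma> F) (T, G)"
    then have *: "V \<in> dom F \<Longrightarrow> sat \<sigma> (eta \<sigma> F V) (T, G)"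
      "V \<in> set (Dom \<sigma>) - dom F \<Longrightarrow> sat \<sigma> (xi \<sigma> V) (T, G)" for V
      by (simp_all only: Phi)
    show "G = F"
    proof
      fix V
      show "G V = F V"
      proof (cases "F V")
        case None
        show ?thesis
        proof (cases "G V")
          case (Some g)
          then have V: "V \<in> set (Dom \<sigma>)" using domG by blast
          with * None have "sat \<sigma> (xi \<sigma> V) (T, G)" by auto
          \<comment> \<open>If only \<open>G\<close> has \<open>V\<close> endogenous,
            \<open>xi\<close> would force \<open>g\<close> to be constant.\<close>
          then have "\<forall>w\<in>Ran_tuple \<sigma> (others \<sigma> V). g w = s V"
            using s by (auto simp: xi[OF V] Some)
          then show ?thesis using function_component_nonconstant[OF G(1) Some] by blast
        qed (simp add: None)
      next
        case F: (Some f)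
        then have V: "V \<in> set (Dom \<sigma>)" using domF by blast
        from * F have "sat \<sigma> (eta \<sigma> F V) (T, G)" by auto
        then have eq: "\<forall>w\<in>Ran_tuple \<sigma> (others \<sigma> V).
            (case G V of None \<Rightarrow> s V | Some g \<Rightarrow> g w) = f w"
          using s by (auto simp: eta[OF V] F)
        show ?thesis
        proof (cases "G V")
          case None
          \<comment> \<open>If only \<open>F\<close> has \<open>V\<close> endogenous,
            \<open>eta\<close> would force \<open>f\<close> to be constant.\<close>
          with eq have "\<forall>w\<in>Ran_tuple \<sigma> (others \<sigma> V). f w = s V" by simp
          then show ?thesis using function_component_nonconstant[OF assms(4) F] by blast
        next
          case (Some g)
          with eq have "g = f"
            using function_component_extensional[OF G(1) Some]
              function_component_extensional[OF assms(4) F]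
            by (intro extensionalityI) auto
          then show ?thesis using F Some by simp
        qed
      qed
    qed
  next
    assume GF: "G = F"
    \<comment> \<open>With \<open>G = F\<close>, both characterizations become reflexive equations
      once the case on \<open>F V\<close> is resolved.\<close>
    note eta' = eta[unfolded GF] and xi' = xi[unfolded GF]
    show "sat \<sigma> (Phi \<sigma> F) (T, G)"
      unfolding Phi unfolding GF using domF by (auto simp: eta' xi' domIff subset_iff)
  qed
qed

end
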